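(* Suppose Assumptions (A) and (B') (stated in the context) hold and $\hat{\boldsymbol\beta}$ is a consistent estimator of $\boldsymbol\beta^\star$ with respect to $r_d\|\cdot\|_2$, i.e. $r_d\|\hat{\boldsymbol\beta}-\boldsymbol\beta^\star\|_2\to0$ in probability, where $r_d$ is a sequence of positive numbers depending on $d$. If $r_d\ge1/\sqrt d$, then $P(\mathcal E)\to1$, where $$\mathcal E=\{\hat\mu_i\ne0\text{ for } i=1,\dots,s_1;\ \text{and } \hat\mu_i=0\text{ for } i=s_1+1,\dots,n\}.$$
   Context: Notation: $a_n\ll b_n$ (equivalently $b_n\gg a_n$) means $a_n=o(b_n)$; all limits are as $n\to\infty$. Model: $d=d_n\to\infty$ with $d\ll n$. For each $n$ the data satisfy $Y_i=\mu_i^\star+\boldsymbol X_i^T\boldsymbol\beta^\star+\epsilon_i$, $1\le i\le n$, where $\boldsymbol\beta^\star\in\mathbb R^d$ and $\boldsymbol\mu^\star\in\mathbb R^n$ are deterministic (and may vary with $n$). The $\boldsymbol X_i$ are i.i.d. copies of a random vector $\boldsymbol X_0\in\mathbb R^d$ with mean zero and positive definite covariance matrix $\boldsymbol\Sigma_X$; they are independent of the $\epsilon_i$, which are i.i.d. copies of a random variable $\epsilon_0$ with mean zero and variance $\sigma^2>0$. $\boldsymbol X$ is the $n\times d$ matrix with rows $\boldsymbol X_i^T$ and $\boldsymbol Y=(Y_1,\dots,Y_n)^T$. Assumption (A): there are positive sequences $\kappa_n\ll\sqrt n$, $\gamma_n\ll\sqrt n$ with $P(\max_{1\le i\le n}\|\boldsymbol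 X_i\|_2>\kappa_n)\to0$ and $P(\max_{1\le i\le n}|\epsilon_i|>\gamma_n)\to0$. Incidental parameters: with $s=s_1+s_2$ and $s_1+s_2=o(n)$: $|\mu_i^\star|\gg\max\{\kappa_n,\gamma_n\}$ for $1\le i\le s_1$; $0<|\mu_i^\star|\le\gamma_n$ for $s_1+1\le i\le s$; $\mu_i^\star=0$ for $s+1\le i\le n$. Let $\mu^\star=\min_{1\le i\le s_1}|\mu_i^\star|$. Assumption (B'): the regularization parameter $\lambda=\lambda_n>0$ satisfies $\sqrt d\,\kappa_n\ll\lambda$, $\alpha\gamma_n\le\lambda$ for a constant $\alpha>2$, and $\lambda\ll\mu^\star$. Estimators: $(\hat{\boldsymbol\mu},\hat{\boldsymbol\beta})$ is a minimizer over $\mathbb R^n\times\mathbb R^d$ of $\|\boldsymbol Y-\boldsymbol\mu-\boldsymbol X\boldsymbol\beta\|_2^2+2\lambda\sum_{i=1}^n|\mu_i|$; in particular $\hat\mu_i=(|Y_i-\boldsymbol X_i^T\hat{\boldsymbol\beta}|-\lambda)_+\,\mathrm{sign}(Y_i-\boldsymbol X_i^T\hat{\boldsymbol\beta})$ for each $i$. *)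

theory Defs
  imports "HOL-Probability.Probability" "HOL-Library.Landau_Symbols"
begin

text \<open>
  The dimensions grow with the sample size, so a vector of length \<open>k\<close> is a function
  \<open>nat \<Rightarrow> real\<close> read on the index set \<open>{1..k}\<close>.  As elements of \<open>\<real>\<^sup>k\<close> with its Borel
  sigma-algebra, such vectors live in the product space below, whose carrier is
  \<open>{1..k} \<rightarrow>\<^sub>E UNIV\<close>.
\<close>

abbreviation euclid :: "nat \<Rightarrow> (nat \<Rightarrow> real) measure" where
  "euclid k \<equiv> Pi\<^sub>M {1..k} (\<lambda>_. borel)"

definition dotp :: "nat \<Rightarrow> (nat \<Rightarrow> real) \<Rightarrow> (nat \<Rightarrow> real) \<Rightarrow> real" where
  "dotp k x b = (\<Sum>j=1..k. x j * b j)"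

definition norm2 :: "nat \<Rightarrow> (nat \<Rightarrow> real) \<Rightarrow> real" where
  "norm2 k x = L2_set x {1..k}"

definition covariance :: "'a measure \<Rightarrow> ('a \<Rightarrow> nat \<Rightarrow> real) \<Rightarrow> nat \<Rightarrow> nat \<Rightarrow> real" where
  "covariance M Z j k =
     (\<integral>\<omega>. (Z \<omega> j - (\<integral>\<omega>'. Z \<omega>' j \<partial>M)) * (Z \<omega> k - (\<integral>\<omega>'. Z \<omega>' k \<partial>M)) \<partial>M)"

text \<open>Symmetry is not demanded; it is automatic for covariance matrices.\<close>

definition pos_def :: "nat \<Rightarrow> (nat \<Rightarrow> nat \<Rightarrow> real) \<Rightarrow> bool" where
  "pos_def k S \<longleftrightarrow>
     (\<forall>v. (\<exists>j\<in>{1..k}. v j \<noteq> 0) \<longrightarrow> (\<Sum>i=1..k. \<Sum>j=1..k. v i * S i j * v j) > 0)"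

definition iid_copies ::
  "'a measure \<Rightarrow> 'c measure \<Rightarrow> 'i set \<Rightarrow> ('i \<Rightarrow> 'a \<Rightarrow> 'c) \<Rightarrow> 'b measure \<Rightarrow> ('b \<Rightarrow> 'c) \<Rightarrow> bool" where
  "iid_copies M N I Z M0 Z0 \<longleftrightarrow>
     prob_space.indep_vars M (\<lambda>_. N) Z I \<and> (\<forall>i\<in>I. distr M N (Z i) = distr M0 N Z0)"

text \<open>
  Independence of two random variables whose value types may differ (the library's
  \<open>indep_var\<close> needs a common type): the generated sigma-algebras are independent.
\<close>

definition indep_rvs ::
  "'a measure \<Rightarrow> 'b measure \<Rightarrow> ('a \<Rightarrow> 'b) \<Rightarrow> 'c measure \<Rightarrow> ('a \<Rightarrow> 'c) \<Rightarrow> bool" where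
  "indep_rvs M S Z T W \<longleftrightarrow> Z \<in> M \<rightarrow>\<^sub>M S \<and> W \<in> M \<rightarrow>\<^sub>M T \<and>
     prob_space.indep_set M
       (sets (vimage_algebra (space M) Z S)) (sets (vimage_algebra (space M) W T))"

text \<open>The probability space may change along the sequence.\<close>

definition tends_to_0_in_prob :: "(nat \<Rightarrow> 'a measure) \<Rightarrow> (nat \<Rightarrow> 'a \<Rightarrow> real) \<Rightarrow> bool" where
  "tends_to_0_in_prob M Z \<longleftrightarrow>
     (\<forall>\<delta>>0. (\<lambda>n. measure (M n) {\<omega> \<in> space (M n). \<bar>Z n \<omega>\<bar> > \<delta>}) \<longlonglongrightarrow> 0)"

definition penalized_loss ::
  "nat \<Rightarrow> nat \<Rightarrow> real \<Rightarrow> (nat \<Rightarrow> real) \<Rightarrow> (nat \<Rightarrow> nat \<Rightarrow> real) \<Rightarrow>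
     (nat \<Rightarrow> real) \<times> (nat \<Rightarrow> real) \<Rightarrow> real" where
  "penalized_loss n d l y x = (\<lambda>(m, b).
     (norm2 n (\<lambda>i. y i - m i - dotp d (x i) b))\<^sup>2 + 2 * l * (\<Sum>i=1..n. \<bar>m i\<bar>))"

definition is_penalized_minimizer ::
  "nat \<Rightarrow> nat \<Rightarrow> real \<Rightarrow> (nat \<Rightarrow> real) \<Rightarrow> (nat \<Rightarrow> nat \<Rightarrow> real) \<Rightarrow>
     (nat \<Rightarrow> real) \<times> (nat \<Rightarrow> real) \<Rightarrow> bool" where
  "is_penalized_minimizer n d l y x mb \<longleftrightarrow>
     is_arg_min (penalized_loss n d l y x) (\<lambda>p. p \<in> space (euclid n) \<times> space (euclid d)) mb"

text \<open>\<open>min {\<bar>m i\<bar> | 1 \<le> i \<le> s}\<close>, the minimum over the empty set being \<open>\<infinity>\<close>.\<close>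

definition min_abs :: "nat \<Rightarrow> (nat \<Rightarrow> real) \<Rightarrow> ereal" where
  "min_abs s m = (if s = 0 then \<infinity> else ereal (Min ((\<lambda>i. \<bar>m i\<bar>) ` {1..s})))"

end

theory Submission
  imports Defs
begin

text \<open>
  In each coordinate the penalized minimizer soft-thresholds the residual
  \<open>Y\<^sub>i - X\<^sub>i\<^sup>T \<beta>\<close> at level \<open>\<lambda>\<close>, so \<open>\<mu>\<^sub>i\<close> vanishes iff that residual is at most \<open>\<lambda>\<close> in
  absolute value.  The residual is \<open>\<mu>\<^sup>\<star>\<^sub>i + \<epsilon>\<^sub>i\<close> up to \<open>X\<^sub>i\<^sup>T (\<beta> - \<beta>\<^sup>\<star>)\<close>.  Off three events of
  vanishing probability \<open>\<bar>\<epsilon>\<^sub>i\<bar> \<le> \<gamma>\<close>, \<open>\<parallel>X\<^sub>i\<parallel> \<le> \<kappa>\<close> and \<open>\<parallel>\<beta> - \<beta>\<^sup>\<star>\<parallel> \<le> 1/r\<^sub>d \<le> \<surd>d\<close>, so by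
  Cauchy--Schwarz the error is at most \<open>\<surd>d \<kappa> = o(\<lambda>)\<close>.  As \<open>2\<gamma> \<le> (2/\<alpha>)\<lambda>\<close> with \<open>2/\<alpha> < 1\<close>, the
  residual is below \<open>\<lambda>\<close> for \<open>i > s\<^sub>1\<close>, and as \<open>\<lambda> = o(\<mu>\<^sup>\<star>)\<close> it exceeds \<open>\<lambda>\<close> for \<open>i \<le> s\<^sub>1\<close>.
\<close>

section \<open>Inner products and norms on \<open>{1..k}\<close>\<close>

lemma abs_dotp_le_norm2: "\<bar>dotp k x b\<bar> \<le> norm2 k x * norm2 k b"
proof -
  have "\<bar>dotp k x b\<bar> \<le> (\<Sum>j=1..k. \<bar>x j * b j\<bar>)"
    unfolding dotp_def by (rule sum_abs)
  also have "\<dots> = (\<Sum>j=1..k. \<bar>x j\<bar> * \<bar>b j\<bar>)"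
    by (simp add: abs_mult)
  also have "\<dots> \<le> norm2 k x * norm2 k b"
    unfolding norm2_def by (rule L2_set_mult_ineq)
  finally show ?thesis .
qed

lemma dotp_diff: "dotp k x (\<lambda>j. b j - c j) = dotp k x b - dotp k x c"
  by (simp add: dotp_def right_diff_distrib sum_subtractf)

lemma norm2_nonneg: "0 \<le> norm2 k x"
  by (simp add: norm2_def)

lemma norm2_power2: "(norm2 k x)\<^sup>2 = (\<Sum>i=1..k. (x i)\<^sup>2)"
  by (simp add: norm2_def L2_set_def sum_nonneg)

lemma borel_measurable_norm2:
  assumes "\<And>j. j \<in> {1..k} \<Longrightarrow> (\<lambda>w. f w j) \<in> borel_measurable M"
  shows "(\<lambda>w. norm2 k (f w)) \<in> borel_measurable M"
  unfolding norm2_def L2_set_def using assms by measurable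

section \<open>Soft thresholding by the penalized minimizer\<close>

text \<open>For fixed \<open>b\<close> the loss is a sum of one-variable functions of the
  \<open>m i\<close>, so replacing \<open>m\<close> by \<open>m(i := t)\<close> alters a single
  summand and joint minimality becomes minimality in each coordinate.\<close>

lemma penalized_minimizer_coord:
  assumes min: "is_penalized_minimizer n d l y x (m, b)" and i: "i \<in> {1..n}"
  shows "(y i - dotp d (x i) b - m i)\<^sup>2 + 2 * l * \<bar>m i\<bar>
       \<le> (y i - dotp d (x i) b - t)\<^sup>2 + 2 * l * \<bar>t\<bar>"
proof -
  define g where "g j u = (y j - u - dotp d (x j) b)\<^sup>2 + 2 * l * \<bar>u\<bar>" for j u
  have loss: "penalized_loss n d l y x (m', b) = (\<Sum>j=1..n. g j (m' j))" for m'
    by (simp add: penalized_loss_def norm2_power2 g_def sum.distrib sum_distrib_left)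
  have split: "(\<Sum>j=1..n. g j (m' j)) = g i (m' i) + (\<Sum>j\<in>{1..n} - {i}. g j (m' j))" for m'
    using i by (simp add: sum.remove)
  have mb: "m \<in> space (euclid n)" "b \<in> space (euclid d)"
    using min by (auto simp: is_penalized_minimizer_def is_arg_min_def)
  \<comment> \<open>The carrier consists of functions that are \<open>undefined\<close> off
    \<open>{1..n}\<close>; the update stays in it because \<open>i\<close> is in the index
    set.\<close>
  have "m(i := t) \<in> space (euclid n)"
    using mb i by (auto simp: space_PiM PiE_iff extensional_def)
  with mb min have "penalized_loss n d l y x (m, b) \<le> penalized_loss n d l y x (m(i := t), b)"
    unfolding is_penalized_minimizer_def is_arg_min_linorder by blast
  moreover have "(\<Sum>j\<in>{1..n} - {i}. g j ((m(i := t)) j)) = (\<Sum>j\<in>{1..n} - {i}. g j (m j))"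
    by (rule sum.cong) auto
  ultimately have "g i (m i) \<le> g i t"
    unfolding loss split by simp
  then show ?thesis
    by (simp add: g_def algebra_simps)
qed

text \<open>A small residual makes 0 strictly better than any nonzero value, and a large one is
  beaten down by its soft threshold. The value of \<open>m i\<close> itself never has to be
  computed.\<close>

lemma penalized_minimizer_eq_0_iff:
  assumes min: "is_penalized_minimizer n d l y x (m, b)" and i: "i \<in> {1..n}" and l: "0 \<le> l"
  shows "m i = 0 \<longleftrightarrow> \<bar>y i - dotp d (x i) b\<bar> \<le> l"
proof -
  define R where "R = y i - dotp d (x i) b"
  have opt: "(R - m i)\<^sup>2 + 2 * l * \<bar>m i\<bar> \<le> (R - t)\<^sup>2 + 2 * l * \<bar>t\<bar>" for t
    unfolding R_def by (rule penalized_minimizer_coord[OF min i])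
  have "m i = 0" if "\<bar>R\<bar> \<le> l"
  proof -
    have "R * m i \<le> \<bar>R\<bar> * \<bar>m i\<bar>"
      by (metis abs_ge_self abs_mult)
    also have "\<dots> \<le> l * \<bar>m i\<bar>"
      using that by (simp add: mult_right_mono)
    \<comment> \<open>Comparison with \<open>t = 0\<close> gives
      \<open>(m i)^2 \<le> 2 * (R * m i - l * \<bar>m i\<bar>)\<close>, whose right side has just
      been shown to be nonpositive.\<close>
    finally have "(m i)\<^sup>2 \<le> 0"
      using opt[of 0] by (simp add: power2_eq_square algebra_simps)
    then show ?thesis by simp
  qed
  moreover have "\<bar>R\<bar> \<le> l" if "m i = 0"
  proof (rule ccontr)
    assume "\<not> \<bar>R\<bar> \<le> l"
    then have gt: "l < \<bar>R\<bar>" by simp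
    \<comment> \<open>The soft threshold of \<open>R\<close> minimizes the one-coordinate loss; it
      improves on 0 by exactly \<open>(\<bar>R\<bar> - l)^2\<close>.\<close>
    define t where "t = sgn R * (\<bar>R\<bar> - l)"
    have "R\<^sup>2 - (R - t)\<^sup>2 - 2 * l * \<bar>t\<bar> = (\<bar>R\<bar> - l)\<^sup>2"
      using gt l by (auto simp: t_def sgn_if abs_if power2_eq_square algebra_simps split: if_splits)
    moreover have "(\<bar>R\<bar> - l)\<^sup>2 > 0"
      using gt by simp
    moreover have "R\<^sup>2 \<le> (R - t)\<^sup>2 + 2 * l * \<bar>t\<bar>"
      using opt[of t] that by simp
    ultimately show False by linarith
  qed
  ultimately show ?thesis
    unfolding R_def by blast
qed

section \<open>Asymptotic comparisons and a union bound\<close>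

text \<open>Once the extended-real ratio is below \<open>1 / K\<close>, the minimum exceeds
  \<open>K * l n\<close>, hence so does every entry. For \<open>s n = 0\<close> the claim is
  vacuous.\<close>

lemma eventually_lt_of_ratio_min_abs:
  assumes lim: "(\<lambda>n. ereal (l n) / min_abs (s n) (m n)) \<longlonglongrightarrow> 0"
    and pos: "\<forall>\<^sub>F n in sequentially. 0 < l n" and K: "0 < (K :: real)"
  shows "\<forall>\<^sub>F n in sequentially. \<forall>i\<in>{1..s n}. K * l n < \<bar>m n i\<bar>"
proof -
  have "\<forall>\<^sub>F n in sequentially. ereal (l n) / min_abs (s n) (m n) < ereal (1 / K)"
    by (rule order_tendstoD(2)[OF lim]) (use K in simp)
  with pos show ?thesis
  proof eventually_elim
    case (elim n)
    show ?case
    proof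
      fix i assume i: "i \<in> {1..s n}"
      define a where "a = Min ((\<lambda>i. \<bar>m n i\<bar>) ` {1..s n})"
      have a_le: "a \<le> \<bar>m n i\<bar>"
        unfolding a_def using i by (intro Min_le) auto
      have "a \<in> (\<lambda>i. \<bar>m n i\<bar>) ` {1..s n}"
        unfolding a_def using i by (intro Min_in) auto
      then have "0 \<le> a" by auto
      have lt: "ereal (l n) / ereal a < ereal (1 / K)"
        using elim(2) i by (auto simp: min_abs_def a_def)
      \<comment> \<open>in \<^typ>\<open>ereal\<close> a positive number divided by 0 is \<open>\<infinity>\<close>\<close>
      then have "a \<noteq> 0"
        using elim(1) by auto
      with \<open>0 \<le> a\<close> have "0 < a" by simp
      then have "l n / a < 1 / K"
        using lt by simp
      then have "K * l n < a"
        using \<open>0 < a\<close> K by (simp add: field_simps)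
      then show "K * l n < \<bar>m n i\<bar>"
        using a_le by simp
    qed
  qed
qed

lemma eventually_le_of_smallo:
  fixes f g :: "nat \<Rightarrow> real"
  assumes "f \<in> o(g)" "c > 0" "\<forall>\<^sub>F n in sequentially. 0 < g n"
  shows "\<forall>\<^sub>F n in sequentially. f n \<le> c * g n"
  using landau_o.smallD[OF assms(1,2)] assms(3) by eventually_elim auto

text \<open>Union bound on the complement of \<open>E n\<close>. The side conditions are only
  eventual, since the model is specified for \<open>n \<ge> 1\<close>.\<close>

lemma prob_tendsto_1_if_compl_covered:
  fixes M :: "nat \<Rightarrow> 'a measure"
  assumes prob: "\<forall>\<^sub>F n in sequentially. prob_space (M n)"
    and E: "\<forall>\<^sub>F n in sequentially. E n \<in> sets (M n)"
    and B: "\<forall>\<^sub>F n in sequentially. \<forall>k\<in>K. B k n \<in> sets (M n)"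
    and fin: "finite K"
    and lim: "\<And>k. k \<in> K \<Longrightarrow> (\<lambda>n. measure (M n) (B k n)) \<longlonglongrightarrow> 0"
    and cover: "\<forall>\<^sub>F n in sequentially. space (M n) - E n \<subseteq> (\<Union>k\<in>K. B k n)"
  shows "(\<lambda>n. measure (M n) (E n)) \<longlonglongrightarrow> 1"
proof (rule tendsto_sandwich)
  show "(\<lambda>n. 1 - (\<Sum>k\<in>K. measure (M n) (B k n))) \<longlonglongrightarrow> 1"
    using tendsto_diff[OF tendsto_const[of "1 :: real"] tendsto_sum[OF lim]] by simp
  show "\<forall>\<^sub>F n in sequentially. 1 - (\<Sum>k\<in>K. measure (M n) (B k n)) \<le> measure (M n) (E n)"
    using prob E B cover
  proof eventually_elim
    case (elim n)
    interpret prob_space "M n" by fact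
    have "prob (space (M n) - E n) \<le> prob (\<Union>k\<in>K. B k n)"
      using elim fin by (intro finite_measure_mono) auto
    also have "\<dots> \<le> (\<Sum>k\<in>K. prob (B k n))"
      using elim fin by (intro finite_measure_subadditive_finite) auto
    finally show ?case
      using prob_compl[OF elim(2)] by simp
  qed
  show "\<forall>\<^sub>F n in sequentially. measure (M n) (E n) \<le> 1"
    using prob by eventually_elim (rule prob_space.prob_le_1)
qed simp

theorem theorem4p4:
  fixes M :: "nat \<Rightarrow> 'a measure" and MX :: "nat \<Rightarrow> 'b measure" and Me :: "'c measure"
    and d s1 s2 :: "nat \<Rightarrow> nat"
    and X :: "nat \<Rightarrow> nat \<Rightarrow> 'a \<Rightarrow> nat \<Rightarrow> real" and X0 :: "nat \<Rightarrow> 'b \<Rightarrow> nat \<Rightarrow> real"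
    and eps :: "nat \<Rightarrow> nat \<Rightarrow> 'a \<Rightarrow> real" and eps0 :: "'c \<Rightarrow> real"
    and Y :: "nat \<Rightarrow> nat \<Rightarrow> 'a \<Rightarrow> real"
    and mu beta :: "nat \<Rightarrow> nat \<Rightarrow> real"
    and muhat betahat :: "nat \<Rightarrow> 'a \<Rightarrow> nat \<Rightarrow> real"
    and kappa gamma lam r :: "nat \<Rightarrow> real"
    and sigma alpha :: real
  (* dimension *)
  assumes d_pos: "\<And>n. n \<ge> 1 \<Longrightarrow> d n \<ge> 1"
    and d_at_top: "filterlim d at_top sequentially"
    and d_small: "(\<lambda>n. real (d n)) \<in> o(\<lambda>n. real n)"
  (* data *)
    and prob_M: "\<And>n. n \<ge> 1 \<Longrightarrow> prob_space (M n)"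
    and prob_MX: "\<And>n. n \<ge> 1 \<Longrightarrow> prob_space (MX n)"
    and prob_Me: "prob_space Me"
    and X0_rv: "\<And>n. n \<ge> 1 \<Longrightarrow> X0 n \<in> MX n \<rightarrow>\<^sub>M euclid (d n)"
    and X0_int: "\<And>n j. n \<ge> 1 \<Longrightarrow> j \<in> {1..d n} \<Longrightarrow>
        integrable (MX n) (\<lambda>w. X0 n w j) \<and> integrable (MX n) (\<lambda>w. (X0 n w j)\<^sup>2)"
    and X0_mean: "\<And>n j. n \<ge> 1 \<Longrightarrow> j \<in> {1..d n} \<Longrightarrow> (\<integral>w. X0 n w j \<partial>MX n) = 0"
    and X0_cov: "\<And>n. n \<ge> 1 \<Longrightarrow> pos_def (d n) (covariance (MX n) (X0 n))"
    and eps0_rv: "eps0 \<in> borel_measurable Me"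
    and eps0_int: "integrable Me eps0" "integrable Me (\<lambda>w. (eps0 w)\<^sup>2)"
    and eps0_mean: "(\<integral>w. eps0 w \<partial>Me) = 0"
    and eps0_var: "prob_space.variance Me eps0 = sigma\<^sup>2" "sigma\<^sup>2 > 0"
    and X_iid: "\<And>n. n \<ge> 1 \<Longrightarrow> iid_copies (M n) (euclid (d n)) {1..n} (X n) (MX n) (X0 n)"
    and eps_iid: "\<And>n. n \<ge> 1 \<Longrightarrow> iid_copies (M n) borel {1..n} (eps n) Me eps0"
    and X_eps_indep: "\<And>n. n \<ge> 1 \<Longrightarrow> indep_rvs (M n)
        (Pi\<^sub>M {1..n} (\<lambda>_. euclid (d n))) (\<lambda>w. \<lambda>i\<in>{1..n}. X n i w)
        (euclid n) (\<lambda>w. \<lambda>i\<in>{1..n}. eps n i w)"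
    and model: "\<And>n i w. n \<ge> 1 \<Longrightarrow> i \<in> {1..n} \<Longrightarrow> w \<in> space (M n) \<Longrightarrow>
        Y n i w = mu n i + dotp (d n) (X n i w) (beta n) + eps n i w"
  (* Assumption (A) *)
    and kappa_gamma_pos: "\<And>n. n \<ge> 1 \<Longrightarrow> kappa n > 0 \<and> gamma n > 0"
    and kappa_small: "kappa \<in> o(\<lambda>n. sqrt (real n))"
    and gamma_small: "gamma \<in> o(\<lambda>n. sqrt (real n))"
    and kappa_max: "(\<lambda>n. measure (M n) {w \<in> space (M n).
        Max ((\<lambda>i. norm2 (d n) (X n i w)) ` {1..n}) > kappa n}) \<longlonglongrightarrow> 0"
    and gamma_max: "(\<lambda>n. measure (M n) {w \<in> space (M n).
        Max ((\<lambda>i. \<bar>eps n i w\<bar>) ` {1..n}) > gamma n}) \<longlonglongrightarrow> 0"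
  (* incidental parameters *)
    and s_le: "\<And>n. n \<ge> 1 \<Longrightarrow> s1 n + s2 n \<le> n"
    and s_small: "(\<lambda>n. real (s1 n + s2 n)) \<in> o(\<lambda>n. real n)"
    and mu_large: "\<And>c. c > 0 \<Longrightarrow> \<forall>\<^sub>F n in sequentially. \<forall>i\<in>{1..s1 n}.
        max (kappa n) (gamma n) \<le> c * \<bar>mu n i\<bar>"
    and mu_medium: "\<And>n i. n \<ge> 1 \<Longrightarrow> i \<in> {s1 n + 1..s1 n + s2 n} \<Longrightarrow>
        0 < \<bar>mu n i\<bar> \<and> \<bar>mu n i\<bar> \<le> gamma n"
    and mu_zero: "\<And>n i. n \<ge> 1 \<Longrightarrow> i \<in> {s1 n + s2 n + 1..n} \<Longrightarrow> mu n i = 0"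
  (* Assumption (B') *)
    and lam_pos: "\<And>n. n \<ge> 1 \<Longrightarrow> lam n > 0"
    and lam_kappa: "(\<lambda>n. sqrt (real (d n)) * kappa n) \<in> o(lam)"
    and lam_gamma: "alpha > 2" "\<And>n. n \<ge> 1 \<Longrightarrow> alpha * gamma n \<le> lam n"
    and lam_mu: "(\<lambda>n. ereal (lam n) / min_abs (s1 n) (mu n)) \<longlonglongrightarrow> 0"
  (* estimators *)
    and muhat_rv: "\<And>n. n \<ge> 1 \<Longrightarrow> muhat n \<in> M n \<rightarrow>\<^sub>M euclid n"
    and betahat_rv: "\<And>n. n \<ge> 1 \<Longrightarrow> betahat n \<in> M n \<rightarrow>\<^sub>M euclid (d n)"
    and minimizer: "\<And>n w. n \<ge> 1 \<Longrightarrow> w \<in> space (M n) \<Longrightarrow>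
        is_penalized_minimizer n (d n) (lam n) (\<lambda>i. Y n i w) (\<lambda>i. X n i w) (muhat n w, betahat n w)"
  (* consistency with respect to the scaled norm *)
    and r_pos: "\<And>k. k \<ge> 1 \<Longrightarrow> r k > 0"
    and consistent: "tends_to_0_in_prob M
        (\<lambda>n w. r (d n) * norm2 (d n) (\<lambda>j. betahat n w j - beta n j))"
    and r_ge: "\<And>k. k \<ge> 1 \<Longrightarrow> r k \<ge> 1 / sqrt (real k)"
  shows "(\<lambda>n. measure (M n) {w \<in> space (M n).
      (\<forall>i\<in>{1..s1 n}. muhat n w i \<noteq> 0) \<and> (\<forall>i\<in>{s1 n + 1..n}. muhat n w i = 0)}) \<longlonglongrightarrow> 1"
proof -
  define A where "A n = {w \<in> space (M n). Max ((\<lambda>i. norm2 (d n) (X n i w)) ` {1..n}) > kappa n}" for n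
  define B where "B n = {w \<in> space (M n). Max ((\<lambda>i. \<bar>eps n i w\<bar>) ` {1..n}) > gamma n}" for n
  \<comment> \<open>Consistency at \<open>\<delta> = 1\<close>: off \<open>C n\<close> the
    estimation error is at most \<open>1 / r (d n)\<close>, hence at most
    \<open>sqrt (d n)\<close>.\<close>
  define C where "C n = {w \<in> space (M n).
    \<bar>r (d n) * norm2 (d n) (\<lambda>j. betahat n w j - beta n j)\<bar> > 1}" for n
  define E where "E n = {w \<in> space (M n).
    (\<forall>i\<in>{1..s1 n}. muhat n w i \<noteq> 0) \<and> (\<forall>i\<in>{s1 n + 1..n}. muhat n w i = 0)}" for n
  define bad where "bad = [A, B, C]"
  \<comment> \<open>The fraction of \<open>lam n\<close> left over after
    \<open>2 * gamma n \<le> (2 / alpha) * lam n\<close>; it is positive because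
    \<open>alpha > 2\<close>.\<close>
  define c where "c = 1 - 2 / alpha"
  have c: "0 < c" "c < 1"
    using lam_gamma(1) by (simp_all add: c_def)
  have ge1: "\<forall>\<^sub>F n in sequentially. (1::nat) \<le> n"
    by (rule eventually_ge_at_top)

  \<comment> \<open>Measurability of the events\<close>
  have A_sets: "A n \<in> sets (M n)" if n: "n \<ge> 1" for n
  proof -
    interpret prob_space "M n" by (rule prob_M[OF n])
    have "X n i \<in> M n \<rightarrow>\<^sub>M euclid (d n)" if "i \<in> {1..n}" for i
      using X_iid[OF n] that by (auto simp: iid_copies_def indep_vars_def)
    then have "(\<lambda>w. X n i w j) \<in> borel_measurable (M n)" if "i \<in> {1..n}" "j \<in> {1..d n}" for i j
      using measurable_compose[OF _ measurable_component_singleton[OF that(2)]] that(1) by blast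
    then have "(\<lambda>w. norm2 (d n) (X n i w)) \<in> borel_measurable (M n)" if "i \<in> {1..n}" for i
      using that by (intro borel_measurable_norm2) auto
    then have [measurable]:
      "(\<lambda>w. Max ((\<lambda>i. norm2 (d n) (X n i w)) ` {1..n})) \<in> borel_measurable (M n)"
      by (intro borel_measurable_Max) auto
    show ?thesis unfolding A_def by measurable
  qed
  have B_sets: "B n \<in> sets (M n)" if n: "n \<ge> 1" for n
  proof -
    interpret prob_space "M n" by (rule prob_M[OF n])
    have "eps n i \<in> borel_measurable (M n)" if "i \<in> {1..n}" for i
      using eps_iid[OF n] that by (auto simp: iid_copies_def indep_vars_def)
    then have [measurable]: "(\<lambda>w. Max ((\<lambda>i. \<bar>eps n i w\<bar>) ` {1..n})) \<in> borel_measurable (M n)"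
      by (intro borel_measurable_Max) auto
    show ?thesis unfolding B_def by measurable
  qed
  have C_sets: "C n \<in> sets (M n)" if n: "n \<ge> 1" for n
  proof -
    have "(\<lambda>w. betahat n w j) \<in> borel_measurable (M n)" if "j \<in> {1..d n}" for j
      using measurable_compose[OF betahat_rv[OF n] measurable_component_singleton[OF that]] .
    then have [measurable]:
      "(\<lambda>w. norm2 (d n) (\<lambda>j. betahat n w j - beta n j)) \<in> borel_measurable (M n)"
      by (intro borel_measurable_norm2) auto
    show ?thesis unfolding C_def by measurable
  qed
  have E_sets: "E n \<in> sets (M n)" if n: "n \<ge> 1" for n
  proof -
    have meas: "(\<lambda>w. muhat n w i) \<in> borel_measurable (M n)" if "i \<in> {1..n}" for i
      using measurable_compose[OF muhat_rv[OF n] measurable_component_singleton[OF that]] .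
    have [measurable]: "(\<lambda>w. muhat n w i) \<in> borel_measurable (M n)" if "i \<in> {1..s1 n}" for i
      using that s_le[OF n] by (intro meas) auto
    have [measurable]: "(\<lambda>w. muhat n w i) \<in> borel_measurable (M n)" if "i \<in> {s1 n + 1..n}" for i
      using that by (intro meas) auto
    show ?thesis unfolding E_def by measurable
  qed

  \<comment> \<open>Correct selection off the three bad events\<close>
  have lam_pos_ev: "\<forall>\<^sub>F n in sequentially. 0 < lam n"
    using ge1 by eventually_elim (rule lam_pos)
  have small: "\<forall>\<^sub>F n in sequentially. sqrt (real (d n)) * kappa n \<le> c * lam n"
    using lam_kappa c(1) lam_pos_ev by (rule eventually_le_of_smallo)
  \<comment> \<open>Noise and estimation error will each be at most \<open>lam n\<close>, so a
    signal above \<open>3 * lam n\<close> leaves a residual above \<open>lam n\<close>.\<close>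
  have large: "\<forall>\<^sub>F n in sequentially. \<forall>i\<in>{1..s1 n}. 3 * lam n < \<bar>mu n i\<bar>"
    using lam_mu lam_pos_ev by (rule eventually_lt_of_ratio_min_abs) simp
  have cover: "\<forall>\<^sub>F n in sequentially. space (M n) - E n \<subseteq> (\<Union>k<3. (bad ! k) n)"
    using ge1 small large
  proof eventually_elim
    case (elim n)
    note n = elim(1)
    have lam0: "0 < lam n" and kappa0: "0 < kappa n" and gamma0: "0 < gamma n"
      using lam_pos[OF n] kappa_gamma_pos[OF n] by auto
    have d1: "1 \<le> d n" by (rule d_pos[OF n])
    have two_gamma: "2 * gamma n \<le> (1 - c) * lam n"
      using lam_gamma(2)[OF n] lam_gamma(1) by (simp add: c_def field_simps)
    have "w \<in> E n" if w: "w \<in> space (M n)" and "w \<notin> A n" "w \<notin> B n" "w \<notin> C n" for w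
    proof -
      define D where "D = (\<lambda>j. betahat n w j - beta n j)"
      have X_le: "norm2 (d n) (X n i w) \<le> kappa n" if "i \<in> {1..n}" for i
        using \<open>w \<notin> A n\<close> w that by (auto simp: A_def not_less)
      have eps_le: "\<bar>eps n i w\<bar> \<le> gamma n" if "i \<in> {1..n}" for i
        using \<open>w \<notin> B n\<close> w that by (auto simp: B_def not_less)
      have "r (d n) * norm2 (d n) D \<le> 1"
        using \<open>w \<notin> C n\<close> w by (auto simp: C_def D_def)
      moreover have "1 / sqrt (real (d n)) * norm2 (d n) D \<le> r (d n) * norm2 (d n) D"
        by (rule mult_right_mono[OF r_ge[OF d1] norm2_nonneg])
      ultimately have "norm2 (d n) D / sqrt (real (d n)) \<le> 1"
        by simp
      then have D_le: "norm2 (d n) D \<le> sqrt (real (d n))"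
        using d1 by (simp add: pos_divide_le_eq)
      have err: "\<bar>dotp (d n) (X n i w) D\<bar> \<le> c * lam n" if "i \<in> {1..n}" for i
      proof -
        have "\<bar>dotp (d n) (X n i w) D\<bar> \<le> norm2 (d n) (X n i w) * norm2 (d n) D"
          by (rule abs_dotp_le_norm2)
        also have "\<dots> \<le> kappa n * sqrt (real (d n))"
          using X_le[OF that] D_le kappa0 by (intro mult_mono) (auto simp: norm2_nonneg)
        also have "\<dots> \<le> c * lam n"
          using elim(2) by (simp add: mult.commute)
        finally show ?thesis .
      qed
      have resid: "Y n i w - dotp (d n) (X n i w) (betahat n w)
          = mu n i + eps n i w - dotp (d n) (X n i w) D" if "i \<in> {1..n}" for i
        unfolding D_def dotp_diff model[OF n that w] by simp
      have zero_iff: "muhat n w i = 0 \<longleftrightarrow>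
          \<bar>mu n i + eps n i w - dotp (d n) (X n i w) D\<bar> \<le> lam n" if "i \<in> {1..n}" for i
        using penalized_minimizer_eq_0_iff[OF minimizer[OF n w] that less_imp_le[OF lam0]]
        unfolding resid[OF that] .
      have "muhat n w i \<noteq> 0" if i: "i \<in> {1..s1 n}" for i
      proof -
        have i': "i \<in> {1..n}" using i s_le[OF n] by auto
        have "c * lam n \<le> lam n" "0 \<le> c * lam n"
          using c lam0 by simp_all
        then have "lam n < \<bar>mu n i + eps n i w - dotp (d n) (X n i w) D\<bar>"
          using bspec[OF elim(3) i] eps_le[OF i'] err[OF i'] two_gamma
          by (simp add: left_diff_distrib)
        then show ?thesis
          unfolding zero_iff[OF i'] by simp
      qed
      moreover have "muhat n w i = 0" if i: "i \<in> {s1 n + 1..n}" for i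
      proof -
        have i': "i \<in> {1..n}" using i by auto
        \<comment> \<open>Medium and zero parameters obey the same bound. Signal and noise then use
          up at most \<open>(1 - c) * lam n\<close> and the error at most \<open>c * lam n\<close>,
          which sum to exactly \<open>lam n\<close>; the threshold condition is non-strict.\<close>
        have "\<bar>mu n i\<bar> \<le> gamma n"
        proof (cases "i \<le> s1 n + s2 n")
          case True
          then show ?thesis using mu_medium[OF n, of i] i by auto
        next
          case False
          then show ?thesis using mu_zero[OF n, of i] i gamma0 by auto
        qed
        then have "\<bar>mu n i + eps n i w - dotp (d n) (X n i w) D\<bar> \<le> lam n"
          using eps_le[OF i'] err[OF i'] two_gamma by (simp add: left_diff_distrib)
        then show ?thesis
          unfolding zero_iff[OF i'] .
      qed
      ultimately show ?thesis
        using w by (simp add: E_def)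
    qed
    then show ?case
      by (auto simp: bad_def numeral_3_eq_3 lessThan_Suc)
  qed

  \<comment> \<open>Passage to the limit\<close>
  have "(\<lambda>n. measure (M n) (E n)) \<longlonglongrightarrow> 1"
  proof (rule prob_tendsto_1_if_compl_covered[where K = "{..<3}" and B = "\<lambda>k. bad ! k"])
    show "\<forall>\<^sub>F n in sequentially. prob_space (M n)"
      using ge1 by eventually_elim (rule prob_M)
    show "\<forall>\<^sub>F n in sequentially. E n \<in> sets (M n)"
      using ge1 by eventually_elim (rule E_sets)
    show "\<forall>\<^sub>F n in sequentially. \<forall>k\<in>{..<3}. (bad ! k) n \<in> sets (M n)"
      using ge1 by eventually_elim
        (auto simp: bad_def numeral_3_eq_3 lessThan_Suc A_sets B_sets C_sets)
    have "(\<lambda>n. measure (M n) (A n)) \<longlonglongrightarrow> 0" "(\<lambda>n. measure (M n) (B n)) \<longlonglongrightarrow> 0"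
      using kappa_max gamma_max unfolding A_def B_def .
    moreover have "(\<lambda>n. measure (M n) (C n)) \<longlonglongrightarrow> 0"
      using consistent unfolding tends_to_0_in_prob_def C_def by simp
    ultimately show "(\<lambda>n. measure (M n) ((bad ! k) n)) \<longlonglongrightarrow> 0" if "k \<in> {..<3}" for k
      using that by (auto simp: bad_def numeral_3_eq_3 lessThan_Suc)
  qed (use cover in auto)
  then show ?thesis
    unfolding E_def .
qed

end
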